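(* Let $F$ satisfy (A0), (A1), (A2), and let $\Theta=\{\theta\in\mathbb R^n:\|\theta\|_\infty\le1\}$. For every constant $c_1>0$ there exist constants $c_2,c>0$ such that, for all sufficiently large $n$: if $p>6\log n/n$, $c_1(\log n)^{-1}\le\varepsilon<1$ and $0\le\delta\le c_2n^{-1}$, then $$\inf_{M\in\mathcal M_{\varepsilon,\delta}}\ \sup_{\theta\in\Theta}\ \mathbb E_{Y|\theta}\|M(Y)-\theta\|_\infty\ \ge\ c\left(\sqrt{\frac{\log n}{np}}+\frac{1}{np\varepsilon}\right),$$ where $\mathcal M_{\varepsilon,\delta}$ is the collection of all $(\varepsilon,\delta)$ edge differentially private estimators of $\theta$.
   Context: Model. There are $n$ items indexed by $[n]$. Each pair $(i,j)$, $1\le i<j\le n$, is compared independently with known probability $p\in(0,1]$; the compared pairs form the edge set of a random graph $\mathcal G$. Given $\mathcal G$, the outcomes $Y_{ij}\in\{0,1\}$, $(i,j)\in\mathcal G$, $i<j$, are independent with $\Pr(Y_{ij}=1)=F(\theta_i-\theta_j)$, and $Y_{ji}=1-Y_{ij}$. $Y$ denotes the whole data set (graph and outcomes) and $\mathbb E_{Y|\theta}$ the expectation over $Y$ (and the randomness of $M$) under parameter $\theta$. Regularity conditions on $F$ ($F$ is twice differentiable): (A0) $F:\mathbb R\to[0,1]$ is strictly increasing and $F(x)=1-F(-x)$ for all $x$. (A1) There is an absolute constant $\kappa_1>0$ with $\sup_{x}\frac{F'(x)}{F(x)(1-F(x))}<\kappa_1$. (A2) $\frac{\partial^2}{\partial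 x^2}(-\log F(x))>0$ for all $x$, and there is an absolute constant $\kappa_2>0$ with $\frac{\partial^2}{\partial x^2}(-\log F(x))<\kappa_2$ for all $x$ and $\min_{|x|\le 4}\frac{\partial^2}{\partial x^2}(-\log F(x))>1/\kappa_2$. Edge differential privacy. Two comparison data sets $(\mathcal G,(y_{ij})_{(i,j)\in\mathcal G})$ and $(\mathcal G',(y'_{ij})_{(i,j)\in\mathcal G'})$ are adjacent if either $\mathcal G=\mathcal G'$ and the outcomes differ on exactly one edge, or $\mathcal G$ is obtained from $\mathcal G\cap\mathcal G'$ by adding one edge and $\mathcal G'$ by adding one different edge, with all outcomes on $\mathcal G\cap\mathcal G'$ equal. A randomized algorithm $M$ is $(\varepsilon,\delta)$ edge differentially private if $\Pr(M(X)\in A)\le e^{\varepsilon}\Pr(M(X')\in A)+\delta$ for all adjacent $X,X'$ and all measurable $A$. The constants $c_2,c$ may depend on $c_1,\kappa_1,\kappa_2$. *)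

theory Defs
  imports "HOL-Probability.Probability"
begin

text \<open>In \<open>cond_A1\<close> the supremum is taken in the extended reals, so
  that the condition includes boundedness. In \<open>cond_A2\<close> the second derivative need not be continuous, so
  the minimum over \<open>[-4, 4]\<close> is read as an infimum; it is over a set bounded below by 0.\<close>

definition neg_log_deriv2 :: "(real \<Rightarrow> real) \<Rightarrow> real \<Rightarrow> real" where
  "neg_log_deriv2 F = deriv (deriv (\<lambda>x. - ln (F x)))"

definition twice_differentiable :: "(real \<Rightarrow> real) \<Rightarrow> bool" where
  "twice_differentiable F \<longleftrightarrow>
     (\<forall>x. F differentiable (at x)) \<and> (\<forall>x. deriv F differentiable (at x))"

definition cond_A0 :: "(real \<Rightarrow> real) \<Rightarrow> bool" where
  "cond_A0 F \<longleftrightarrow> range F \<subseteq> {0..1} \<and> strict_mono F \<and> (\<forall>x. F x = 1 - F (- x))"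

definition cond_A1 :: "real \<Rightarrow> (real \<Rightarrow> real) \<Rightarrow> bool" where
  "cond_A1 \<kappa>\<^sub>1 F \<longleftrightarrow> (SUP x. ereal (deriv F x / (F x * (1 - F x)))) < ereal \<kappa>\<^sub>1"

definition cond_A2 :: "real \<Rightarrow> (real \<Rightarrow> real) \<Rightarrow> bool" where
  "cond_A2 \<kappa>\<^sub>2 F \<longleftrightarrow>
     (\<forall>x. neg_log_deriv2 F x > 0) \<and>
     (\<forall>x. neg_log_deriv2 F x < \<kappa>\<^sub>2) \<and>
     (INF x\<in>{x. \<bar>x\<bar> \<le> 4}. neg_log_deriv2 F x) > 1 / \<kappa>\<^sub>2"

definition regular_link :: "real \<Rightarrow> real \<Rightarrow> (real \<Rightarrow> real) \<Rightarrow> bool" where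
  "regular_link \<kappa>\<^sub>1 \<kappa>\<^sub>2 F \<longleftrightarrow>
     twice_differentiable F \<and> cond_A0 F \<and> cond_A1 \<kappa>\<^sub>1 F \<and> cond_A2 \<kappa>\<^sub>2 F"

text \<open>A comparison data set is a partial map whose domain is the set of compared pairs \<open>(i, j)\<close>,
  \<open>i < j\<close>; the value \<open>True\<close> encodes the outcome \<open>Y\<^sub>i\<^sub>j = 1\<close> and \<open>False\<close> encodes \<open>Y\<^sub>i\<^sub>j = 0\<close>. The
  reversed outcomes \<open>Y\<^sub>j\<^sub>i = 1 - Y\<^sub>i\<^sub>j\<close> are determined and not stored.\<close>

type_synonym dataset = "nat \<times> nat \<rightharpoonup> bool"

definition item_pairs :: "nat \<Rightarrow> (nat \<times> nat) set" where
  "item_pairs n = {(i, j). 1 \<le> i \<and> i < j \<and> j \<le> n}"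

definition datasets :: "nat \<Rightarrow> dataset set" where
  "datasets n = {D. dom D \<subseteq> item_pairs n}"

definition graph_pmf :: "nat \<Rightarrow> real \<Rightarrow> (nat \<times> nat) set pmf" where
  "graph_pmf n p =
     map_pmf (\<lambda>g. {e \<in> item_pairs n. g e}) (Pi_pmf (item_pairs n) False (\<lambda>_. bernoulli_pmf p))"

definition outcome_pmf ::
  "(real \<Rightarrow> real) \<Rightarrow> (nat \<Rightarrow> real) \<Rightarrow> (nat \<times> nat) set \<Rightarrow> dataset pmf" where
  "outcome_pmf F \<theta> G =
     Pi_pmf G None (\<lambda>(i, j). map_pmf Some (bernoulli_pmf (F (\<theta> i - \<theta> j))))"

definition data_pmf ::
  "(real \<Rightarrow> real) \<Rightarrow> nat \<Rightarrow> real \<Rightarrow> (nat \<Rightarrow> real) \<Rightarrow> dataset pmf" where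
  "data_pmf F n p \<theta> = bind_pmf (graph_pmf n p) (outcome_pmf F \<theta>)"

definition adjacent :: "dataset \<Rightarrow> dataset \<Rightarrow> bool" where
  "adjacent D D' \<longleftrightarrow>
     (dom D = dom D' \<and> card {e \<in> dom D. D e \<noteq> D' e} = 1) \<or>
     (\<exists>e e'. e \<noteq> e' \<and> e \<notin> dom D \<inter> dom D' \<and> e' \<notin> dom D \<inter> dom D' \<and>
        dom D = insert e (dom D \<inter> dom D') \<and> dom D' = insert e' (dom D \<inter> dom D') \<and>
        (\<forall>a \<in> dom D \<inter> dom D'. D a = D' a))"

text \<open>\<open>\<real>\<^sup>n\<close> is the product space of functions on \<open>{1..n}\<close>, extended by \<open>undefined\<close>.\<close>

abbreviation Rn :: "nat \<Rightarrow> (nat \<Rightarrow> real) measure" where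
  "Rn n \<equiv> Pi\<^sub>M {1..n} (\<lambda>_. borel)"

text \<open>Only meaningful for \<open>n \<ge> 1\<close>.\<close>

definition linf_norm :: "nat \<Rightarrow> (nat \<Rightarrow> real) \<Rightarrow> real" where
  "linf_norm n x = (MAX i\<in>{1..n}. \<bar>x i\<bar>)"

definition Theta :: "nat \<Rightarrow> (nat \<Rightarrow> real) set" where
  "Theta n = {\<theta> \<in> space (Rn n). linf_norm n \<theta> \<le> 1}"

text \<open>A randomized estimator is a Markov kernel from data sets to \<open>\<real>\<^sup>n\<close>: \<open>M D\<close> is the law of the
  output on input \<open>D\<close>. There are finitely many data sets, all subsets of which are measurable.\<close>

definition randomized_estimator :: "nat \<Rightarrow> (dataset \<Rightarrow> (nat \<Rightarrow> real) measure) \<Rightarrow> bool" where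
  "randomized_estimator n M \<longleftrightarrow> M \<in> count_space (datasets n) \<rightarrow>\<^sub>M prob_algebra (Rn n)"

definition edge_dp ::
  "nat \<Rightarrow> real \<Rightarrow> real \<Rightarrow> (dataset \<Rightarrow> (nat \<Rightarrow> real) measure) \<Rightarrow> bool" where
  "edge_dp n \<epsilon> \<delta> M \<longleftrightarrow>
     (\<forall>D \<in> datasets n. \<forall>D' \<in> datasets n. adjacent D D' \<longrightarrow>
        (\<forall>A \<in> sets (Rn n). measure (M D) A \<le> exp \<epsilon> * measure (M D') A + \<delta>))"

definition private_estimators ::
  "nat \<Rightarrow> real \<Rightarrow> real \<Rightarrow> (dataset \<Rightarrow> (nat \<Rightarrow> real) measure) set" where
  "private_estimators n \<epsilon> \<delta> = {M. randomized_estimator n M \<and> edge_dp n \<epsilon> \<delta> M}"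

text \<open>The expected loss, over the data and the internal randomness of \<open>M\<close>; it may be infinite.\<close>

definition risk ::
  "(real \<Rightarrow> real) \<Rightarrow> nat \<Rightarrow> real \<Rightarrow> (nat \<Rightarrow> real) \<Rightarrow> (dataset \<Rightarrow> (nat \<Rightarrow> real) measure) \<Rightarrow> ennreal" where
  "risk F n p \<theta> M =
     (\<integral>\<^sup>+ D. (\<integral>\<^sup>+ x. ennreal (linf_norm n (\<lambda>i. x i - \<theta> i)) \<partial>M D) \<partial>measure_pmf (data_pmf F n p \<theta>))"

end

theory Submission
  imports Defs
begin

text \<open>Since \<open>n p > 6 ln n\<close> and \<open>\<epsilon> \<ge> c\<^sub>1 / ln n\<close>, the privacy term \<open>1 / (n p \<epsilon>)\<close> is at most
  \<open>ln n / (c\<^sub>1 n p) \<le> s / c\<^sub>1\<close> for \<open>s = sqrt (ln n / (n p))\<close>, so it suffices to bound the risk of an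
  arbitrary, not necessarily private, estimator from below by a multiple of \<open>s\<close>. Take the \<open>n\<close>
  hypotheses \<open>\<theta>\<^sub>k = \<Delta> e\<^sub>k\<close> with \<open>\<Delta>\<close> proportional to \<open>s\<close>. The sup-norm balls of radius \<open>\<Delta> / 2\<close> around
  them are disjoint, so the probabilities \<open>g\<^sub>k\<close> that the estimator falls into them sum to at most 1.
  Let \<open>L\<^sub>k\<close> be the likelihood ratio of \<open>\<theta>\<^sub>k\<close> against fair outcomes. By AM-GM,
  \<open>L\<^sub>k g\<^sub>k \<le> n g\<^sub>k / 4 + L\<^sub>k\<^sup>2 / n\<close>, and the second moment of \<open>L\<^sub>k\<close> is at most
  \<open>exp (n p \<kappa>\<^sub>1\<^sup>2 \<Delta>\<^sup>2 / 4) \<le> sqrt n\<close>. Hence some hypothesis is missed with probability at least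
  1/2.\<close>

section \<open>Change of measure through a second moment\<close>

text \<open>Follows by integrating the AM-GM bound
  \<open>L * g \<le> T / 2 * g\<^sup>2 + L\<^sup>2 / (2 * T)\<close> and using
  \<open>g\<^sup>2 \<le> g\<close>. The result is linear in the \<open>Q\<close>-integral of
  \<open>g\<close>, so it can be summed over many disjoint events; \<open>T\<close> balances the two
  terms.\<close>

lemma nn_integral_change_of_measure_le:
  fixes P Q :: "'a pmf" and L g :: "'a \<Rightarrow> real" and T :: real
  assumes dens: "\<And>y. pmf P y = L y * pmf Q y"
    and L: "\<And>y. 0 \<le> L y"
    and g: "\<And>y. 0 \<le> g y" "\<And>y. g y \<le> 1"
    and T: "0 < T"
  shows "(\<integral>\<^sup>+y. ennreal (g y) \<partial>P) \<le>
    ennreal (T / 2) * (\<integral>\<^sup>+y. ennreal (g y) \<partial>Q)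
      + ennreal (1 / (2 * T)) * (\<integral>\<^sup>+y. ennreal ((L y)\<^sup>2) \<partial>Q)"
proof -
  have pw: "L y * g y \<le> T / 2 * g y + 1 / (2 * T) * (L y)\<^sup>2" for y
  proof -
    have "0 \<le> (T * g y - L y)\<^sup>2 / (2 * T)" using T by simp
    also have "\<dots> = T / 2 * (g y * g y) + 1 / (2 * T) * (L y)\<^sup>2 - L y * g y"
      using T by (simp add: power2_eq_square field_simps)
    finally have "L y * g y \<le> T / 2 * (g y * g y) + 1 / (2 * T) * (L y)\<^sup>2" by simp
    moreover have "T / 2 * (g y * g y) \<le> T / 2 * g y"
      using T g by (intro mult_left_mono) (auto simp: mult_left_le)
    ultimately show ?thesis by linarith
  qed
  have "(\<integral>\<^sup>+y. ennreal (g y) \<partial>P) = (\<integral>\<^sup>+y. ennreal (L y * g y) \<partial>Q)"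
    unfolding nn_integral_measure_pmf
    by (intro nn_integral_cong) (simp add: dens L g ennreal_mult[symmetric] mult_ac)
  also have "\<dots> \<le> (\<integral>\<^sup>+y. ennreal (T / 2) * ennreal (g y)
      + ennreal (1 / (2 * T)) * ennreal ((L y)\<^sup>2) \<partial>Q)"
  proof (rule nn_integral_mono)
    fix y
    have "ennreal (T / 2) * ennreal (g y) + ennreal (1 / (2 * T)) * ennreal ((L y)\<^sup>2)
      = ennreal (T / 2 * g y + 1 / (2 * T) * (L y)\<^sup>2)"
      using T g by (subst ennreal_plus) (auto simp: ennreal_mult[symmetric])
    thus "ennreal (L y * g y) \<le>
        ennreal (T / 2) * ennreal (g y) + ennreal (1 / (2 * T)) * ennreal ((L y)\<^sup>2)"
      using pw[of y] by (simp add: ennreal_leI)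
  qed
  also have "\<dots> = ennreal (T / 2) * (\<integral>\<^sup>+y. ennreal (g y) \<partial>Q)
      + ennreal (1 / (2 * T)) * (\<integral>\<^sup>+y. ennreal ((L y)\<^sup>2) \<partial>Q)"
    by (simp add: nn_integral_add nn_integral_cmult)
  finally show ?thesis .
qed

section \<open>Second moments of likelihood ratios for comparison data\<close>

lemma finite_item_pairs: "finite (item_pairs n)"
  by (rule finite_subset[of _ "{1..n} \<times> {1..n}"]) (auto simp: item_pairs_def)

lemma set_graph_pmf_subset: "G \<in> set_pmf (graph_pmf n p) \<Longrightarrow> G \<subseteq> item_pairs n"
  by (auto simp: graph_pmf_def)

text \<open>An estimator is constrained only on \<open>datasets n\<close>; this makes its values
  elsewhere irrelevant to the risk.\<close>

lemma set_data_pmf_subset: "set_pmf (data_pmf F n p \<theta>) \<subseteq> datasets n"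
proof
  fix D assume "D \<in> set_pmf (data_pmf F n p \<theta>)"
  then obtain G where G: "G \<subseteq> item_pairs n" and D: "D \<in> set_pmf (outcome_pmf F \<theta> G)"
    by (auto simp: data_pmf_def dest: set_graph_pmf_subset)
  have "finite G" using G finite_item_pairs by (rule finite_subset)
  hence "\<forall>x. x \<notin> G \<longrightarrow> D x = None"
    using D set_Pi_pmf_subset unfolding outcome_pmf_def by fastforce
  hence "dom D \<subseteq> G" by (metis domIff subsetI)
  thus "D \<in> datasets n" using G by (auto simp: datasets_def)
qed

text \<open>Given the graph, outcomes are independent, so the likelihood ratio against fair coins
  and its second moment factor over the edges. An edge with success probability \<open>q\<close>
  contributes \<open>(4 * q\<^sup>2 + 4 * (1 - q)\<^sup>2) / 2 = 1 + (2 * q -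
  1)\<^sup>2\<close>.\<close>

lemma nn_integral_outcome_pmf_le:
  fixes F :: "real \<Rightarrow> real" and g :: "dataset \<Rightarrow> real" and T :: real
  assumes "finite G" and F: "\<And>x. 0 \<le> F x" "\<And>x. F x \<le> 1"
    and g: "\<And>D. 0 \<le> g D" "\<And>D. g D \<le> 1" and T: "0 < T"
  shows "(\<integral>\<^sup>+D. ennreal (g D) \<partial>outcome_pmf F \<theta> G) \<le>
    ennreal (T / 2) * (\<integral>\<^sup>+D. ennreal (g D) \<partial>outcome_pmf (\<lambda>_. 1 / 2) (\<lambda>_. 0) G)
      + ennreal (1 / (2 * T)) * (\<Prod>(i, j)\<in>G. ennreal (1 + (2 * F (\<theta> i - \<theta> j) - 1)\<^sup>2))"
proof -
  define P where "P = (\<lambda>(i, j). map_pmf Some (bernoulli_pmf (F (\<theta> i - \<theta> j))))"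
  define H where "H = map_pmf Some (bernoulli_pmf (1 / 2))"
  define L where "L D = (\<Prod>e\<in>G. 2 * pmf (P e) (D e))" for D
  \<comment> \<open>Neither law charges \<open>None\<close>, and \<open>H\<close> gives mass 1/2 to
    each outcome, so \<open>2 * pmf (P e)\<close> is the density with respect to
    \<open>H\<close>.\<close>
  have H: "pmf (P e) y = 2 * pmf (P e) y * pmf H y" for e y
  proof (cases y)
    case None
    thus ?thesis by (cases e) (auto simp: P_def pmf_map_outside)
  next
    case (Some b)
    thus ?thesis by (auto simp: H_def pmf_map_inj')
  qed
  have null: "outcome_pmf (\<lambda>_. 1 / 2) (\<lambda>_. 0) G = Pi_pmf G None (\<lambda>_. H)"
    by (simp add: outcome_pmf_def H_def case_prod_unfold)
  have alt: "outcome_pmf F \<theta> G = Pi_pmf G None P"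
    by (simp add: outcome_pmf_def P_def)
  have dens: "pmf (Pi_pmf G None P) D = L D * pmf (Pi_pmf G None (\<lambda>_. H)) D" for D
    by (auto simp: pmf_Pi[OF \<open>finite G\<close>] L_def H[symmetric] simp flip: prod.distrib)
  have sq: "(\<integral>\<^sup>+y. ennreal ((2 * pmf (P e) y)\<^sup>2) \<partial>H)
      = (case e of (i, j) \<Rightarrow> ennreal (1 + (2 * F (\<theta> i - \<theta> j) - 1)\<^sup>2))" for e
  proof (cases e)
    case (Pair i j)
    define q where "q = F (\<theta> i - \<theta> j)"
    have q: "0 \<le> q" "q \<le> 1" using F by (auto simp: q_def)
    have "(\<integral>\<^sup>+y. ennreal ((2 * pmf (P e) y)\<^sup>2) \<partial>H)
        = ennreal (4 * q\<^sup>2) * ennreal (1 / 2) + ennreal (4 * (1 - q)\<^sup>2) * ennreal (1 / 2)"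
      using q by (simp add: H_def P_def Pair pmf_map_inj' power_mult_distrib flip: q_def)
    also have "\<dots> = ennreal (4 * q\<^sup>2 * (1 / 2)) + ennreal (4 * (1 - q)\<^sup>2 * (1 / 2))"
      by (intro arg_cong2[where f = "(+)"] ennreal_mult[symmetric]) auto
    also have "\<dots> = ennreal (4 * q\<^sup>2 * (1 / 2) + 4 * (1 - q)\<^sup>2 * (1 / 2))"
      by (rule ennreal_plus[symmetric]) auto
    also have "4 * q\<^sup>2 * (1 / 2) + 4 * (1 - q)\<^sup>2 * (1 / 2) = 1 + (2 * q - 1)\<^sup>2"
      by (simp add: power2_eq_square algebra_simps)
    finally show ?thesis by (simp add: Pair q_def)
  qed
  have "(\<integral>\<^sup>+D. ennreal ((L D)\<^sup>2) \<partial>Pi_pmf G None (\<lambda>_. H))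
      = (\<integral>\<^sup>+D. (\<Prod>e\<in>G. ennreal ((2 * pmf (P e) (D e))\<^sup>2)) \<partial>Pi_pmf G None (\<lambda>_. H))"
    by (simp add: L_def prod_power_distrib prod_ennreal)
  also have "\<dots> = (\<Prod>e\<in>G. \<integral>\<^sup>+y. ennreal ((2 * pmf (P e) y)\<^sup>2) \<partial>H)"
    by (rule nn_integral_prod_Pi_pmf[OF \<open>finite G\<close>])
  finally have L2: "(\<integral>\<^sup>+D. ennreal ((L D)\<^sup>2) \<partial>Pi_pmf G None (\<lambda>_. H))
      = (\<Prod>(i, j)\<in>G. ennreal (1 + (2 * F (\<theta> i - \<theta> j) - 1)\<^sup>2))"
    unfolding sq .
  have "0 \<le> L D" for D by (auto simp: L_def intro!: prod_nonneg)
  from nn_integral_change_of_measure_le[where L = L and g = g, OF dens this g T]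
  show ?thesis unfolding L2 null alt .
qed

text \<open>Pairs enter the graph independently with probability \<open>p\<close>, so the mean of
  the product is the product of \<open>1 + p * s e\<close>, each at most
  \<open>exp (p * s e)\<close>.\<close>

lemma nn_integral_graph_pmf_prod_le:
  fixes s :: "nat \<times> nat \<Rightarrow> real"
  assumes p: "0 \<le> p" "p \<le> 1" and s: "\<And>e. 0 \<le> s e"
  shows "(\<integral>\<^sup>+G. (\<Prod>e\<in>G. ennreal (1 + s e)) \<partial>graph_pmf n p)
    \<le> ennreal (exp (p * (\<Sum>e\<in>item_pairs n. s e)))"
proof -
  let ?A = "item_pairs n"
  \<comment> \<open>The product over a random edge set becomes a product over all pairs, absent
    pairs contributing the factor 1, so that independence applies.\<close>
  have "(\<integral>\<^sup>+G. (\<Prod>e\<in>G. ennreal (1 + s e)) \<partial>graph_pmf n p)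
      = (\<integral>\<^sup>+g. (\<Prod>e\<in>?A. if g e then ennreal (1 + s e) else 1)
          \<partial>Pi_pmf ?A False (\<lambda>_. bernoulli_pmf p))"
    using finite_item_pairs by (simp add: graph_pmf_def prod.inter_filter)
  also have "\<dots> = (\<Prod>e\<in>?A. \<integral>\<^sup>+b. (if b then ennreal (1 + s e) else 1) \<partial>bernoulli_pmf p)"
    by (rule nn_integral_prod_Pi_pmf[OF finite_item_pairs,
          where f = "\<lambda>e b. if b then ennreal (1 + s e) else 1"])
  also have "\<dots> = (\<Prod>e\<in>?A. ennreal (1 + p * s e))"
  proof (rule prod.cong[OF refl])
    fix e
    have "(\<integral>\<^sup>+b. (if b then ennreal (1 + s e) else 1) \<partial>bernoulli_pmf p)
        = ennreal ((1 + s e) * p) + ennreal (1 - p)"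
      using p s[of e] by (simp add: ennreal_mult)
    also have "\<dots> = ennreal ((1 + s e) * p + (1 - p))"
      using p s[of e] by (subst ennreal_plus) auto
    finally show "(\<integral>\<^sup>+b. (if b then ennreal (1 + s e) else 1) \<partial>bernoulli_pmf p)
        = ennreal (1 + p * s e)"
      by (simp add: algebra_simps)
  qed
  also have "\<dots> \<le> (\<Prod>e\<in>?A. ennreal (exp (p * s e)))"
    by (intro prod_mono_ennreal ennreal_leI exp_ge_add_one_self)
  also have "\<dots> = ennreal (exp (p * (\<Sum>e\<in>?A. s e)))"
    by (simp add: prod_ennreal exp_sum finite_item_pairs sum_distrib_left)
  finally show ?thesis .
qed

text \<open>The graph has the same law under the hypothesis and the fair-coin reference, so the
  bound conditional on the graph can be averaged over it.\<close>

lemma nn_integral_data_pmf_le: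
  fixes F :: "real \<Rightarrow> real" and \<theta> :: "nat \<Rightarrow> real" and g :: "dataset \<Rightarrow> real"
    and p T :: real
  assumes F: "\<And>x. 0 \<le> F x" "\<And>x. F x \<le> 1" and p: "0 \<le> p" "p \<le> 1"
    and g: "\<And>D. 0 \<le> g D" "\<And>D. g D \<le> 1" and T: "0 < T"
  shows "(\<integral>\<^sup>+D. ennreal (g D) \<partial>data_pmf F n p \<theta>) \<le>
    ennreal (T / 2) * (\<integral>\<^sup>+D. ennreal (g D) \<partial>data_pmf (\<lambda>_. 1 / 2) n p (\<lambda>_. 0))
      + ennreal (1 / (2 * T)) *
        ennreal (exp (p * (\<Sum>(i, j)\<in>item_pairs n. (2 * F (\<theta> i - \<theta> j) - 1)\<^sup>2)))"
proof -
  let ?s = "\<lambda>(i, j). (2 * F (\<theta> i - \<theta> j) - 1)\<^sup>2"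
  let ?I = "\<lambda>G. \<integral>\<^sup>+D. ennreal (g D) \<partial>outcome_pmf (\<lambda>_. 1 / 2) (\<lambda>_. 0) G"
  have "(\<integral>\<^sup>+D. ennreal (g D) \<partial>data_pmf F n p \<theta>)
      = (\<integral>\<^sup>+G. \<integral>\<^sup>+D. ennreal (g D) \<partial>outcome_pmf F \<theta> G \<partial>graph_pmf n p)"
    by (simp add: data_pmf_def)
  also have "\<dots> \<le> (\<integral>\<^sup>+G. ennreal (T / 2) * ?I G
      + ennreal (1 / (2 * T)) * (\<Prod>e\<in>G. ennreal (1 + ?s e)) \<partial>graph_pmf n p)"
  proof (rule nn_integral_mono_AE, rule AE_pmfI)
    fix G assume "G \<in> set_pmf (graph_pmf n p)"
    hence "finite G" by (rule finite_subset[OF set_graph_pmf_subset finite_item_pairs])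
    from nn_integral_outcome_pmf_le[where F = F and g = g and \<theta> = \<theta>, OF this F g T]
    show "(\<integral>\<^sup>+D. ennreal (g D) \<partial>outcome_pmf F \<theta> G) \<le> ennreal (T / 2) * ?I G
      + ennreal (1 / (2 * T)) * (\<Prod>e\<in>G. ennreal (1 + ?s e))"
      by (simp add: case_prod_unfold)
  qed
  also have "\<dots> = ennreal (T / 2) * (\<integral>\<^sup>+G. ?I G \<partial>graph_pmf n p)
      + ennreal (1 / (2 * T)) * (\<integral>\<^sup>+G. (\<Prod>e\<in>G. ennreal (1 + ?s e)) \<partial>graph_pmf n p)"
    by (simp add: nn_integral_add nn_integral_cmult)
  also have "\<dots> \<le> ennreal (T / 2) * (\<integral>\<^sup>+G. ?I G \<partial>graph_pmf n p)
      + ennreal (1 / (2 * T)) * ennreal (exp (p * (\<Sum>e\<in>item_pairs n. ?s e)))"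
    by (intro add_left_mono mult_left_mono nn_integral_graph_pmf_prod_le p) auto
  finally show ?thesis by (simp add: data_pmf_def)
qed

section \<open>Deviation of the link function from 1/2\<close>

text \<open>Strict monotonicity excludes the endpoint values; hence the denominator in
  \<open>cond_A1\<close> is positive.\<close>

lemma regular_link_bounds:
  assumes "regular_link \<kappa>\<^sub>1 \<kappa>\<^sub>2 F"
  shows "0 < F x" and "F x < 1"
proof -
  from assms have r: "range F \<subseteq> {0..1}" and m: "strict_mono F"
    unfolding regular_link_def cond_A0_def by blast+
  have F01: "0 \<le> F y" "F y \<le> 1" for y using subsetD[OF r rangeI[of F y]] by auto
  have "0 \<le> F (x - 1)" "F (x - 1) < F x" "F x < F (x + 1)" "F (x + 1) \<le> 1"
    using m F01 by (auto simp: strict_mono_def)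
  thus "0 < F x" "F x < 1" by auto
qed

lemma regular_link_deriv_le:
  assumes "regular_link \<kappa>\<^sub>1 \<kappa>\<^sub>2 F" "0 \<le> \<kappa>\<^sub>1"
  shows "deriv F x \<le> \<kappa>\<^sub>1 / 4"
proof -
  have pos: "0 < F x * (1 - F x)" using regular_link_bounds[OF assms(1), of x] by simp
  have "ereal (deriv F x / (F x * (1 - F x)))
      \<le> (SUP x. ereal (deriv F x / (F x * (1 - F x))))"
    by (rule SUP_upper) simp
  also have "\<dots> < ereal \<kappa>\<^sub>1" using assms by (simp add: regular_link_def cond_A1_def)
  finally have "deriv F x < \<kappa>\<^sub>1 * (F x * (1 - F x))" using pos by (simp add: field_simps)
  moreover have "F x * (1 - F x) \<le> 1 / 4"
    using zero_le_power2[of "2 * F x - 1"] by (simp add: power2_eq_square algebra_simps)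
  hence "\<kappa>\<^sub>1 * (F x * (1 - F x)) \<le> \<kappa>\<^sub>1 * (1 / 4)" using assms(2) by (rule mult_left_mono)
  ultimately show ?thesis by simp
qed

text \<open>Symmetry gives \<open>F 0 = 1 / 2\<close>, and the mean value theorem with slope at most
  \<open>\<kappa>\<^sub>1 / 4\<close> bounds \<open>2 * F x - 1\<close> for nonnegative
  \<open>x\<close>; oddness of \<open>2 * F x - 1\<close> covers the rest.\<close>

lemma regular_link_deviation:
  assumes F: "regular_link \<kappa>\<^sub>1 \<kappa>\<^sub>2 F" and "0 \<le> \<kappa>\<^sub>1"
  shows "(2 * F x - 1)\<^sup>2 \<le> (\<kappa>\<^sub>1 * x / 2)\<^sup>2"
proof -
  have symm: "F x = 1 - F (- x)" for x
    using F unfolding regular_link_def cond_A0_def by blast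
  have F0: "F 0 = 1 / 2" using symm[of 0] unfolding minus_zero by linarith
  have mono: "strict_mono F"
    using F unfolding regular_link_def cond_A0_def by blast
  have nonneg: "(2 * F x - 1)\<^sup>2 \<le> (\<kappa>\<^sub>1 * x / 2)\<^sup>2" if "0 \<le> x" for x
  proof (cases "x = 0")
    case True
    thus ?thesis by (simp add: F0)
  next
    case False
    have "(F has_real_derivative deriv F y) (at y)" for y
      using F by (auto simp: regular_link_def twice_differentiable_def
          DERIV_deriv_iff_real_differentiable)
    with MVT2[of 0 x F "deriv F"] False that
    obtain z where z: "F x - F 0 = x * deriv F z" by auto
    have "x * deriv F z \<le> x * (\<kappa>\<^sub>1 / 4)"
      using that regular_link_deriv_le[OF assms] by (intro mult_left_mono)
    \<comment> \<open>Squaring the upper bound requires \<open>2 * F x - 1\<close> to be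
      nonnegative.\<close>
    moreover have "F 0 \<le> F x"
      using mono that by (simp add: strict_mono_less_eq)
    ultimately have "0 \<le> 2 * F x - 1" "2 * F x - 1 \<le> \<kappa>\<^sub>1 * x / 2"
      using z F0 by (auto simp: mult.commute)
    thus ?thesis by (intro power_mono)
  qed
  show ?thesis
  proof (cases "0 \<le> x")
    case False
    hence "(2 * F (- x) - 1)\<^sup>2 \<le> (\<kappa>\<^sub>1 * (- x) / 2)\<^sup>2" by (intro nonneg) simp
    moreover have eq: "2 * F (- x) - 1 = - (2 * F x - 1)"
      using symm[of x] by linarith
    have "(2 * F (- x) - 1)\<^sup>2 = (2 * F x - 1)\<^sup>2"
      unfolding eq by (rule power2_minus)
    ultimately show ?thesis by simp
  qed (rule nonneg)
qed

section \<open>Spike hypotheses and disjoint sup-norm balls\<close>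

text \<open>Only pairs containing \<open>k\<close> see a nonzero difference, and there are at most
  \<open>n\<close> of them. Both signs of \<open>\<Delta>\<close> occur because \<open>k\<close> may
  be the smaller or the larger index.\<close>

lemma sum_spike_le:
  fixes f :: "real \<Rightarrow> real" and n k :: nat
  assumes f0: "f 0 = 0" and f: "f \<Delta> \<le> b" "f (- \<Delta>) \<le> b" and b: "0 \<le> b"
    and k: "k \<in> {1..n}"
    and \<theta>: "\<And>i. i \<in> {1..n} \<Longrightarrow> \<theta> i = (if i = k then \<Delta> else 0)"
  shows "(\<Sum>(i, j)\<in>item_pairs n. f (\<theta> i - \<theta> j)) \<le> real n * b"
proof -
  let ?A = "item_pairs n" and ?S = "{(i, j) \<in> item_pairs n. i = k \<or> j = k}"
  have "(\<Sum>(i, j)\<in>?A. f (\<theta> i - \<theta> j)) = (\<Sum>(i, j)\<in>?S. f (\<theta> i - \<theta> j))"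
    by (rule sum.mono_neutral_right)
      (use finite_item_pairs in \<open>auto simp: item_pairs_def \<theta> f0 split: if_splits\<close>)
  also have "\<dots> \<le> (\<Sum>e\<in>?S. b)"
    by (rule sum_mono) (use k f in \<open>auto simp: item_pairs_def \<theta>\<close>)
  also have "\<dots> = real (card ?S) * b" by simp
  also have "card ?S \<le> n"
  proof -
    have "card ?S \<le> card {1..n}"
    proof (rule card_inj_on_le)
      \<comment> \<open>The map sends a pair containing \<open>k\<close> to its other
        member.\<close>
      show "inj_on (\<lambda>(i, j). if i = k then j else i) ?S"
        by (auto simp: inj_on_def item_pairs_def split: if_splits)
    qed (auto simp: item_pairs_def)
    thus ?thesis by simp
  qed
  hence "real (card ?S) * b \<le> real n * b" using b by (intro mult_right_mono) auto
  finally show ?thesis by simp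
qed

text \<open>The restriction to \<open>{1..n}\<close> places the vector in
  \<open>space (Rn n)\<close>, as \<open>Theta\<close> demands.\<close>

definition spike :: "nat \<Rightarrow> real \<Rightarrow> nat \<Rightarrow> nat \<Rightarrow> real" where
  "spike n \<Delta> k = (\<lambda>i\<in>{1..n}. if i = k then \<Delta> else 0)"

lemma spike_in_Theta:
  assumes "1 \<le> n" "0 \<le> \<Delta>" "\<Delta> \<le> 1"
  shows "spike n \<Delta> k \<in> Theta n"
  using assms by (auto simp: Theta_def spike_def linf_norm_def space_PiM)

text \<open>For \<open>n \<ge> 1\<close> this is the open sup-norm ball, written coordinatewise to
  make measurability immediate.\<close>

definition sup_box :: "nat \<Rightarrow> real \<Rightarrow> (nat \<Rightarrow> real) \<Rightarrow> (nat \<Rightarrow> real) set" where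
  "sup_box n r \<theta> = {x \<in> space (Rn n). \<forall>i\<in>{1..n}. \<bar>x i - \<theta> i\<bar> < r}"

lemma sup_box_sets: "sup_box n r \<theta> \<in> sets (Rn n)"
  unfolding sup_box_def by measurable

text \<open>Coordinate \<open>k\<close> separates the boxes: the centres have the values
  \<open>\<Delta>\<close> and 0 there, and no number is strictly within \<open>\<Delta> / 2\<close>
  of both.\<close>

lemma disjoint_family_sup_box_spike:
  "disjoint_family_on (\<lambda>k. sup_box n (\<Delta> / 2) (spike n \<Delta> k)) {1..n}"
  unfolding disjoint_family_on_def
proof (intro ballI impI)
  fix k l assume kl: "k \<in> {1..n}" "l \<in> {1..n}" "k \<noteq> l"
  show "sup_box n (\<Delta> / 2) (spike n \<Delta> k) \<inter> sup_box n (\<Delta> / 2) (spike n \<Delta> l) = {}"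
  proof (rule equals0I)
    fix x assume "x \<in> sup_box n (\<Delta> / 2) (spike n \<Delta> k) \<inter> sup_box n (\<Delta> / 2) (spike n \<Delta> l)"
    hence "\<bar>x k - spike n \<Delta> k k\<bar> < \<Delta> / 2" "\<bar>x k - spike n \<Delta> l k\<bar> < \<Delta> / 2"
      using kl by (auto simp: sup_box_def)
    thus False using kl by (auto simp: spike_def)
  qed
qed

section \<open>From missed balls to risk\<close>

text \<open>Markov's inequality for the output law on one data set: outside the box some coordinate
  errs by at least \<open>r\<close>.\<close>

lemma linf_loss_ge:
  assumes "prob_space N" and N: "sets N = sets (Rn n)" and "1 \<le> n" "0 \<le> r"
  shows "ennreal r * ennreal (1 - measure N (sup_box n r \<theta>))
    \<le> (\<integral>\<^sup>+x. ennreal (linf_norm n (\<lambda>i. x i - \<theta> i)) \<partial>N)"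
proof -
  interpret prob_space N by fact
  let ?B = "sup_box n r \<theta>"
  have B: "?B \<in> sets N" unfolding N by (rule sup_box_sets)
  have sp: "space N = space (Rn n)" using N by (rule sets_eq_imp_space_eq)
  have "ennreal r * ennreal (1 - measure N ?B) = ennreal r * emeasure N (space N - ?B)"
    using B by (simp add: emeasure_eq_measure prob_compl)
  also have "\<dots> = (\<integral>\<^sup>+x. ennreal r * indicator (space N - ?B) x \<partial>N)"
    using B by (simp add: nn_integral_cmult_indicator)
  also have "\<dots> \<le> (\<integral>\<^sup>+x. ennreal (linf_norm n (\<lambda>i. x i - \<theta> i)) \<partial>N)"
  proof (rule nn_integral_mono)
    fix x assume x: "x \<in> space N"
    show "ennreal r * indicator (space N - ?B) x \<le> ennreal (linf_norm n (\<lambda>i. x i - \<theta> i))"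
    proof (cases "x \<in> ?B")
      case False
      then obtain i where i: "i \<in> {1..n}" "r \<le> \<bar>x i - \<theta> i\<bar>"
        using x by (force simp: sup_box_def sp)
      have "r \<le> linf_norm n (\<lambda>i. x i - \<theta> i)"
        unfolding linf_norm_def by (rule order.trans[OF i(2)]) (use i in \<open>auto intro!: Max_ge\<close>)
      thus ?thesis using False x by (simp add: ennreal_leI)
    qed simp
  qed
  finally show ?thesis .
qed

text \<open>Averages \<open>linf_loss_ge\<close> over the data. The value 0 outside
  \<open>datasets n\<close>, where \<open>M D\<close> need not be a probability measure, keeps the
  integrand in [0, 1] everywhere.\<close>

lemma risk_ge_half:
  fixes r :: real
  assumes M: "randomized_estimator n M" and "1 \<le> n" "0 \<le> r"
    and half: "(\<integral>\<^sup>+D. ennreal (if D \<in> datasets n then measure (M D) (sup_box n r \<theta>) else 0)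
      \<partial>data_pmf F n p \<theta>) \<le> ennreal (1 / 2)"
  shows "ennreal (r / 2) \<le> risk F n p \<theta> M"
proof -
  let ?P = "data_pmf F n p \<theta>"
  let ?g = "\<lambda>D. if D \<in> datasets n then measure (M D) (sup_box n r \<theta>) else 0"
  have MD: "prob_space (M D)" "sets (M D) = sets (Rn n)" if "D \<in> datasets n" for D
    using M that by (auto simp: randomized_estimator_def space_prob_algebra dest: measurable_space)
  have g: "0 \<le> ?g D" "?g D \<le> 1" for D
    using MD(1) by (auto simp: prob_space.prob_le_1)
  \<comment> \<open>The complementary probability is obtained by adding the two integrals and
    cancelling the one that \<open>half\<close> shows to be finite.\<close>
  have split: "(\<integral>\<^sup>+D. ennreal (1 - ?g D) \<partial>?P) + (\<integral>\<^sup>+D. ennreal (?g D) \<partial>?P) = 1"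
  proof -
    have "(\<integral>\<^sup>+D. ennreal (1 - ?g D) \<partial>?P) + (\<integral>\<^sup>+D. ennreal (?g D) \<partial>?P)
        = (\<integral>\<^sup>+D. ennreal (1 - ?g D) + ennreal (?g D) \<partial>?P)"
      by (rule nn_integral_add[symmetric]) auto
    also have "\<dots> = (\<integral>\<^sup>+D. 1 \<partial>?P)"
      using g by (intro nn_integral_cong) (subst ennreal_plus[symmetric], auto)
    finally show ?thesis by simp
  qed
  have "ennreal (1 / 2) = ennreal (1 - 1 / 2)" by simp
  also have "\<dots> = 1 - ennreal (1 / 2)"
    by (subst ennreal_minus[symmetric]) auto
  also have "\<dots> \<le> 1 - (\<integral>\<^sup>+D. ennreal (?g D) \<partial>?P)"
    using half by (intro ennreal_minus_mono) auto
  also have "\<dots> = (\<integral>\<^sup>+D. ennreal (1 - ?g D) \<partial>?P)"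
    using half unfolding split[symmetric]
    by (intro ennreal_add_diff_cancel_right) (auto simp: top_unique)
  finally have "ennreal (1 / 2) \<le> (\<integral>\<^sup>+D. ennreal (1 - ?g D) \<partial>?P)" .
  hence "ennreal r * ennreal (1 / 2) \<le> ennreal r * (\<integral>\<^sup>+D. ennreal (1 - ?g D) \<partial>?P)"
    by (rule mult_left_mono) simp
  also have "\<dots> = (\<integral>\<^sup>+D. ennreal r * ennreal (1 - ?g D) \<partial>?P)"
    by (simp add: nn_integral_cmult)
  also have "\<dots> \<le> risk F n p \<theta> M"
    unfolding risk_def
  proof (rule nn_integral_mono_AE, rule AE_pmfI)
    fix D assume "D \<in> set_pmf ?P"
    hence "D \<in> datasets n" by (rule subsetD[OF set_data_pmf_subset])
    thus "ennreal r * ennreal (1 - ?g D)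
        \<le> (\<integral>\<^sup>+x. ennreal (linf_norm n (\<lambda>i. x i - \<theta> i)) \<partial>M D)"
      using linf_loss_ge[OF MD \<open>1 \<le> n\<close> \<open>0 \<le> r\<close>] by simp
  qed
  also have "ennreal r * ennreal (1 / 2) = ennreal (r * (1 / 2))"
    using \<open>0 \<le> r\<close> by (intro ennreal_mult[symmetric]) auto
  finally show ?thesis by simp
qed

section \<open>Averaging over the hypotheses\<close>

text \<open>All hypotheses are compared with one fair-coin law, under which the disjoint boxes have
  total probability at most 1. The hit probabilities then sum to at most
  \<open>n / 4 + sqrt n \<le> n / 2\<close>, so one of them is at most 1/2.\<close>

lemma exists_spike_missed:
  assumes F: "regular_link \<kappa>\<^sub>1 \<kappa>\<^sub>2 F" "0 \<le> \<kappa>\<^sub>1" and p: "0 \<le> p" "p \<le> 1"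
    and n: "16 \<le> n" and \<Delta>: "real n * p * (\<kappa>\<^sub>1 * \<Delta> / 2)\<^sup>2 \<le> ln (real n) / 2"
    and M: "randomized_estimator n M"
  shows "\<exists>k\<in>{1..n}. (\<integral>\<^sup>+D. ennreal (if D \<in> datasets n
      then measure (M D) (sup_box n (\<Delta> / 2) (spike n \<Delta> k)) else 0)
      \<partial>data_pmf F n p (spike n \<Delta> k)) \<le> ennreal (1 / 2)"
proof -
  define g where "g k D = (if D \<in> datasets n
      then measure (M D) (sup_box n (\<Delta> / 2) (spike n \<Delta> k)) else 0)" for k D
  define I where "I k = (\<integral>\<^sup>+D. ennreal (g k D) \<partial>data_pmf F n p (spike n \<Delta> k))" for k
  let ?Q = "data_pmf (\<lambda>_. 1 / 2) n p (\<lambda>_. 0)"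
  have MD: "prob_space (M D)" "sets (M D) = sets (Rn n)" if "D \<in> datasets n" for D
    using M that by (auto simp: randomized_estimator_def space_prob_algebra dest: measurable_space)
  have g: "0 \<le> g k D" "g k D \<le> 1" for k D
    using MD(1) by (auto simp: g_def prob_space.prob_le_1)
  have gsum: "(\<Sum>k=1..n. g k D) \<le> 1" for D
  proof (cases "D \<in> datasets n")
    case True
    then interpret prob_space "M D" by (rule MD)
    have "(\<Sum>k=1..n. g k D) = measure (M D) (\<Union>k\<in>{1..n}. sup_box n (\<Delta> / 2) (spike n \<Delta> k))"
      unfolding g_def using True disjoint_family_sup_box_spike
      by (subst finite_measure_finite_Union) (auto simp: MD(2) simp del: One_nat_def intro: sup_box_sets)
    thus ?thesis by simp
  qed (simp add: g_def)
  have F01: "0 \<le> F x" "F x \<le> 1" for x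
    using regular_link_bounds[OF F(1), of x] by auto
  have I_le: "I k \<le> ennreal (real n / 4) * (\<integral>\<^sup>+D. ennreal (g k D) \<partial>?Q)
      + ennreal (sqrt (real n) / real n)" if k: "k \<in> {1..n}" for k
  proof -
    let ?\<theta> = "spike n \<Delta> k"
    define S where "S = (\<Sum>(i, j)\<in>item_pairs n. (2 * F (?\<theta> i - ?\<theta> j) - 1)\<^sup>2)"
    have F0: "2 * F 0 - 1 = 0"
      using regular_link_deviation[OF F, of 0] by simp
    have "S \<le> real n * (\<kappa>\<^sub>1 * \<Delta> / 2)\<^sup>2"
      unfolding S_def
      by (rule sum_spike_le[where f = "\<lambda>t. (2 * F t - 1)\<^sup>2" and \<Delta> = \<Delta> and k = k])
        (use k F0 regular_link_deviation[OF F, of \<Delta>] regular_link_deviation[OF F, of "- \<Delta>"]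
         in \<open>auto simp: spike_def\<close>)
    hence "p * S \<le> p * (real n * (\<kappa>\<^sub>1 * \<Delta> / 2)\<^sup>2)" using p by (intro mult_left_mono)
    also have "\<dots> \<le> ln (real n) / 2" using \<Delta> by (simp add: mult_ac)
    finally have "exp (p * S) \<le> exp (ln (real n) / 2)" by simp
    also have "\<dots> = sqrt (real n)" using n by (simp add: ln_sqrt[symmetric])
    finally have V: "exp (p * S) \<le> sqrt (real n)" .
    \<comment> \<open>Taking \<open>T = n / 2\<close> gives the second moment the weight
      \<open>1 / n\<close>, so the \<open>n\<close> such terms add up to at most
      \<open>sqrt n\<close>.\<close>
    have "I k \<le> ennreal (real n / 2 / 2) * (\<integral>\<^sup>+D. ennreal (g k D) \<partial>?Q)
        + ennreal (1 / (2 * (real n / 2))) * ennreal (exp (p * S))"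
      unfolding I_def S_def using n by (intro nn_integral_data_pmf_le F01 p g) auto
    also have "ennreal (1 / (2 * (real n / 2))) * ennreal (exp (p * S))
        \<le> ennreal (sqrt (real n) / real n)"
      using V n by (subst ennreal_mult[symmetric]) (auto intro!: ennreal_leI divide_right_mono)
    finally show ?thesis by (simp add: add_left_mono)
  qed
  have "(\<Sum>k=1..n. I k) \<le> (\<Sum>k=1..n. ennreal (real n / 4) * (\<integral>\<^sup>+D. ennreal (g k D) \<partial>?Q)
      + ennreal (sqrt (real n) / real n))"
    by (intro sum_mono I_le)
  also have "\<dots> = ennreal (real n / 4) * (\<integral>\<^sup>+D. ennreal (\<Sum>k=1..n. g k D) \<partial>?Q)
      + ennreal (sqrt (real n))"
  proof -
    have "of_nat n * ennreal (sqrt (real n) / real n)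
        = ennreal (real n * (sqrt (real n) / real n))"
      unfolding ennreal_of_nat_eq_real_of_nat by (rule ennreal_mult[symmetric]) auto
    hence "of_nat n * ennreal (sqrt (real n) / real n) = ennreal (sqrt (real n))"
      using n by simp
    moreover have "(\<Sum>k=1..n. \<integral>\<^sup>+D. ennreal (g k D) \<partial>?Q)
        = (\<integral>\<^sup>+D. ennreal (\<Sum>k=1..n. g k D) \<partial>?Q)"
      using g by (simp add: nn_integral_sum[symmetric] sum_ennreal)
    ultimately show ?thesis by (simp add: sum.distrib flip: sum_distrib_left)
  qed
  also have "\<dots> \<le> ennreal (real n / 4) * 1 + ennreal (real n / 4)"
  proof (intro add_mono mult_left_mono ennreal_leI)
    have "(\<integral>\<^sup>+D. ennreal (\<Sum>k=1..n. g k D) \<partial>?Q) \<le> (\<integral>\<^sup>+D. 1 \<partial>?Q)"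
      using gsum by (intro nn_integral_mono) (metis ennreal_1 ennreal_leI)
    thus "(\<integral>\<^sup>+D. ennreal (\<Sum>k=1..n. g k D) \<partial>?Q) \<le> 1" by simp
    \<comment> \<open>The threshold 16 on \<open>n\<close> is what makes
      \<open>sqrt n \<le> n / 4\<close>.\<close>
    have "4 \<le> sqrt (real n)" using n by (intro real_le_rsqrt) auto
    hence "4 * sqrt (real n) \<le> sqrt (real n) * sqrt (real n)" by (intro mult_right_mono) auto
    thus "sqrt (real n) \<le> real n / 4" by simp
  qed auto
  also have "\<dots> = ennreal (real n / 2)" by (simp flip: ennreal_plus)
  finally have total: "(\<Sum>k=1..n. I k) \<le> ennreal (real n / 2)" .
  have "\<exists>k\<in>{1..n}. I k \<le> ennreal (1 / 2)"
  proof (rule ccontr)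
    assume "\<not> ?thesis"
    hence big: "\<And>k. k \<in> {1..n} \<Longrightarrow> ennreal (1 / 2) < I k" by (auto simp: not_le)
    have "ennreal (real n / 2) = (\<Sum>k=1..n. ennreal (1 / 2))"
      by (subst sum_ennreal) auto
    also have "\<dots> < (\<Sum>k=1..n. I k)"
    proof -
      have "finite {1..n}" "{1..n} \<noteq> {}" using n by auto
      thus ?thesis using big
        by (induction rule: finite_ne_induct) (auto simp del: sum_constant intro: add_strict_mono)
    qed
    finally show False using total by simp
  qed
  thus ?thesis by (simp add: I_def g_def)
qed

section \<open>Choice of constants and the final rate\<close>

theorem theorem2p2:
  fixes \<kappa>\<^sub>1 \<kappa>\<^sub>2 c\<^sub>1 :: real
  assumes "\<kappa>\<^sub>1 > 0" and "\<kappa>\<^sub>2 > 0" and "c\<^sub>1 > 0"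
  shows "\<exists>c\<^sub>2>0. \<exists>c>0. \<forall>\<^sub>F n in sequentially. \<forall>F p \<epsilon> \<delta>.
    regular_link \<kappa>\<^sub>1 \<kappa>\<^sub>2 F \<longrightarrow>
    0 < p \<longrightarrow> p \<le> 1 \<longrightarrow> p > 6 * ln (real n) / real n \<longrightarrow>
    c\<^sub>1 * inverse (ln (real n)) \<le> \<epsilon> \<longrightarrow> \<epsilon> < 1 \<longrightarrow>
    0 \<le> \<delta> \<longrightarrow> \<delta> \<le> c\<^sub>2 * inverse (real n) \<longrightarrow>
    (INF M \<in> private_estimators n \<epsilon> \<delta>. SUP \<theta> \<in> Theta n. risk F n p \<theta> M)
      \<ge> ennreal (c * (sqrt (ln (real n) / (real n * p)) + 1 / (real n * p * \<epsilon>)))"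
proof -
  \<comment> \<open>The bound \<open>a \<le> 1\<close> keeps the spikes in \<open>Theta\<close>;
    \<open>\<kappa>\<^sub>1 * a \<le> 1\<close> keeps the second moment below
    \<open>sqrt n\<close>.\<close>
  define a where "a = min 1 (1 / \<kappa>\<^sub>1)"
  define w where "w = 1 + 1 / c\<^sub>1"
  have w: "0 < w" using assms by (simp add: w_def add_pos_pos)
  \<comment> \<open>The 4 combines the radius \<open>\<Delta> / 2\<close> with the miss probability
    1/2; \<open>w\<close> absorbs both rates through
    \<open>s + s / c\<^sub>1 = w * s\<close>.\<close>
  define c where "c = a / 4 / w"
  have a: "0 < a" "a \<le> 1" "\<kappa>\<^sub>1 * a \<le> 1"
    using assms by (auto simp: a_def min_def field_simps)
  have "0 < c" using a w by (simp add: c_def)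
  have main: "ennreal (c * (sqrt (ln (real n) / (real n * p)) + 1 / (real n * p * \<epsilon>)))
      \<le> (SUP \<theta> \<in> Theta n. risk F n p \<theta> M)"
    if n: "16 \<le> n" and F: "regular_link \<kappa>\<^sub>1 \<kappa>\<^sub>2 F" and p: "0 < p" "p \<le> 1"
      and np: "p > 6 * ln (real n) / real n" and \<epsilon>: "c\<^sub>1 * inverse (ln (real n)) \<le> \<epsilon>"
      and M: "randomized_estimator n M" for n F p \<epsilon> M
  proof -
    define s where "s = sqrt (ln (real n) / (real n * p))"
    define \<Delta> where "\<Delta> = a * s"
    have ln: "0 < ln (real n)" using n by simp
    have npos: "0 < real n * p" using n p by simp
    have s2: "s * s = ln (real n) / (real n * p)"
      using ln npos by (simp add: s_def)
    \<comment> \<open>The lower bound on \<open>p\<close> yields \<open>s \<le> 1\<close>, used both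
      for membership in \<open>Theta\<close> and for \<open>s * s \<le> s\<close> below.\<close>
    have "6 * ln (real n) < real n * p" using np n by (simp add: field_simps)
    hence "ln (real n) / (real n * p) \<le> 1" using ln npos by (simp add: field_simps)
    hence s: "0 \<le> s" "s \<le> 1" using ln npos by (auto simp: s_def)
    have \<Delta>: "0 \<le> \<Delta>" "\<Delta> \<le> 1"
      using a s by (auto simp: \<Delta>_def mult_le_one)
    have "real n * p * (\<kappa>\<^sub>1 * \<Delta> / 2)\<^sup>2 = (\<kappa>\<^sub>1 * a)\<^sup>2 / 4 * (real n * p * (s * s))"
      by (simp add: \<Delta>_def power2_eq_square)
    also have "real n * p * (s * s) = ln (real n)" unfolding s2 using n p by simp
    also have "(\<kappa>\<^sub>1 * a)\<^sup>2 / 4 * ln (real n) \<le> 1 / 2 * ln (real n)"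
    proof (rule mult_right_mono)
      have "(\<kappa>\<^sub>1 * a)\<^sup>2 \<le> 1" using a assms by (intro power_le_one) auto
      thus "(\<kappa>\<^sub>1 * a)\<^sup>2 / 4 \<le> 1 / 2" by simp
    qed (use ln in simp)
    finally have \<Delta>2: "real n * p * (\<kappa>\<^sub>1 * \<Delta> / 2)\<^sup>2 \<le> ln (real n) / 2" by simp
    obtain k where k: "k \<in> {1..n}" and half: "(\<integral>\<^sup>+D. ennreal (if D \<in> datasets n
        then measure (M D) (sup_box n (\<Delta> / 2) (spike n \<Delta> k)) else 0)
        \<partial>data_pmf F n p (spike n \<Delta> k)) \<le> ennreal (1 / 2)"
      using exists_spike_missed[OF F _ _ p(2) n \<Delta>2 M] p assms by auto
    \<comment> \<open>From \<open>1 / \<epsilon> \<le> ln n / c\<^sub>1\<close> the privacy rate is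
      at most \<open>s * s / c\<^sub>1\<close>, and \<open>s \<le> 1\<close> removes one
      factor.\<close>
    have "1 / (real n * p * \<epsilon>) \<le> s / c\<^sub>1"
    proof -
      have "c\<^sub>1 \<le> \<epsilon> * ln (real n)" using \<epsilon> ln by (simp add: field_simps)
      moreover have "0 < c\<^sub>1 * inverse (ln (real n))" using assms ln by simp
      hence e: "0 < \<epsilon>" using \<epsilon> by linarith
      ultimately have "1 / \<epsilon> \<le> ln (real n) / c\<^sub>1" using assms by (simp add: field_simps)
      hence "1 / \<epsilon> / (real n * p) \<le> ln (real n) / c\<^sub>1 / (real n * p)"
        using npos by (intro divide_right_mono) auto
      also have "\<dots> = s * s / c\<^sub>1" by (simp add: s2)
      also have "\<dots> \<le> s / c\<^sub>1" using s assms by (intro divide_right_mono) (auto simp: mult_left_le)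
      finally show ?thesis by (simp add: mult_ac)
    qed
    hence "c * (s + 1 / (real n * p * \<epsilon>)) \<le> c * (s + s / c\<^sub>1)"
      using \<open>0 < c\<close> by (intro mult_left_mono) auto
    also have "\<dots> = c * w * s" by (simp add: w_def algebra_simps)
    also have "c * w = a / 4" using w by (simp add: c_def)
    also have "a / 4 * s = \<Delta> / 2 / 2" by (simp add: \<Delta>_def)
    finally have "ennreal (c * (s + 1 / (real n * p * \<epsilon>))) \<le> ennreal (\<Delta> / 2 / 2)"
      by (rule ennreal_leI)
    also have "\<dots> \<le> risk F n p (spike n \<Delta> k) M"
      using n \<Delta> half M by (intro risk_ge_half) auto
    also have "\<dots> \<le> (SUP \<theta> \<in> Theta n. risk F n p \<theta> M)"
      using n \<Delta> by (intro SUP_upper spike_in_Theta) auto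
    finally show ?thesis by (simp add: s_def)
  qed
  show ?thesis
  proof (rule exI[of _ 1], intro conjI exI[of _ c])
    show "\<forall>\<^sub>F n in sequentially. \<forall>F p \<epsilon> \<delta>.
      regular_link \<kappa>\<^sub>1 \<kappa>\<^sub>2 F \<longrightarrow>
      0 < p \<longrightarrow> p \<le> 1 \<longrightarrow> p > 6 * ln (real n) / real n \<longrightarrow>
      c\<^sub>1 * inverse (ln (real n)) \<le> \<epsilon> \<longrightarrow> \<epsilon> < 1 \<longrightarrow>
      0 \<le> \<delta> \<longrightarrow> \<delta> \<le> 1 * inverse (real n) \<longrightarrow>
      (INF M \<in> private_estimators n \<epsilon> \<delta>. SUP \<theta> \<in> Theta n. risk F n p \<theta> M)
        \<ge> ennreal (c * (sqrt (ln (real n) / (real n * p)) + 1 / (real n * p * \<epsilon>)))"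
      using eventually_ge_at_top[of 16]
      by eventually_elim (auto intro!: INF_greatest main simp: private_estimators_def)
  qed (use \<open>0 < c\<close> in auto)
qed

end
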